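(* Let $N\ge1$, let $E\subset\mathbb{C}^N$ be compact and let $q$ be an $E$-admissible norm on $\mathbb{P}(\mathbb{C}^N)$. Then $$m^*(q)=\lim_{k\to\infty}\frac1k m_k(q)=m(E)$$ (in particular the limit exists). In particular, $m(E)\le m(q)$.
   Context: $\mathbb{P}(\mathbb{C}^N)$ is the complex vector space of all polynomials in $N$ variables with complex coefficients, $\deg P$ is the total degree, and $\|P\|_E=\sup_{E}|P|$. A norm $q$ on $\mathbb{P}(\mathbb{C}^N)$ is $E$-admissible (has Nikolskii's property) if there exist constants $A,B>0$ and $a,b\ge0$ such that for every $P\in\mathbb{P}(\mathbb{C}^N)$ with $\deg P\ge1$, $$\|P\|_E\le A(\deg P)^a q(P)\quad\text{and}\quad q(P)\le B(\deg P)^b\|P\|_E.$$ For a norm $q$ on $\mathbb{P}(\mathbb{C}^N)$ and a multi-index $\alpha\in\mathbb{Z}_{\ge0}^N$ with $|\alpha|=\alpha_1+\dots+\alpha_N\ge1$, let $D^\alpha=\partial^{|\alpha|}/\partial x_1^{\alpha_1}\cdots\partial x_N^{\alpha_N}$ and $$m(\alpha,q)=\inf\{s>0:\ \exists M>0\ \forall P\in\mathbb{P}(\mathbb{C}^N)\ \ q(D^\alpha P)\le M(\deg P)^s q(P)\},$$ with $\inf\emptyset=+\infty$. For $k\ge1$ put $m_k(q)=\max\{m(\alpha,q):|\alpha|=k\}$. Markov's exponent of $q$ is $m(q)=m_1(q)$. The asymptotic exponent of $q$ is $m^*(q)=\limsup_{k\to\infty}\frac1k m_k(q)$. Markov's exponent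 of $E$ is $m(E)=m(\|\cdot\|_E)$. *)

theory Defs
  imports "HOL-Analysis.Analysis" "HOL-Library.Poly_Mapping"
begin

text \<open>
  The polynomials in the variables \<open>x\<^sub>i\<close> (\<open>i :: 'n\<close>, so \<open>N = CARD('n) \<ge> 1\<close>) with complex
  coefficients are the finitely supported maps from multi-indices to coefficients, with the
  convolution product of \<^theory>\<open>HOL-Library.Poly_Mapping\<close>.
\<close>

type_synonym 'n multi_index = "'n \<Rightarrow>\<^sub>0 nat"

type_synonym 'n cpoly = "'n multi_index \<Rightarrow>\<^sub>0 complex"

definition mi_size :: "'n::finite multi_index \<Rightarrow> nat"  (* |alpha| *)
  where "mi_size \<alpha> = (\<Sum>i\<in>UNIV. Poly_Mapping.lookup \<alpha> i)"

definition const_poly :: "complex \<Rightarrow> 'n cpoly"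
  where "const_poly c = Poly_Mapping.single 0 c"

definition eval_poly :: "'n::finite cpoly \<Rightarrow> complex ^ 'n \<Rightarrow> complex"
  where "eval_poly P x =
    (\<Sum>\<beta>\<in>Poly_Mapping.keys P.
       Poly_Mapping.lookup P \<beta> * (\<Prod>i\<in>UNIV. (x $ i) ^ Poly_Mapping.lookup \<beta> i))"

text \<open>Total degree; the zero polynomial gets degree \<open>0\<close>.\<close>

definition total_deg :: "'n::finite cpoly \<Rightarrow> nat"
  where "total_deg P = Max (insert 0 (mi_size ` Poly_Mapping.keys P))"

definition sup_norm :: "(complex ^ 'n::finite) set \<Rightarrow> 'n cpoly \<Rightarrow> real"
  where "sup_norm E P = (SUP x\<in>E. norm (eval_poly P x))"

text \<open>
  Formal partial derivative: \<open>x\<^sup>\<beta>\<close> is sent to \<open>\<beta>\<^sub>i x\<^bsup>\<beta> - e\<^sub>i\<^esup>\<close>. The subtraction is truncated, but the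
  coefficient vanishes when \<open>\<beta>\<^sub>i = 0\<close>.
\<close>

definition partial_deriv :: "'n \<Rightarrow> 'n cpoly \<Rightarrow> 'n cpoly"
  where "partial_deriv i P =
    (\<Sum>\<beta>\<in>Poly_Mapping.keys P.
       Poly_Mapping.single (\<beta> - Poly_Mapping.single i 1)
         (of_nat (Poly_Mapping.lookup \<beta> i) * Poly_Mapping.lookup P \<beta>))"

text \<open>
  \<open>D\<^sup>\<alpha>\<close> as the iterated partial derivative. The order in which the fold visits the variables
  does not matter, by \<open>comp_fun_commute_partial_deriv\<close> below.
\<close>

definition mi_deriv :: "'n::finite multi_index \<Rightarrow> 'n cpoly \<Rightarrow> 'n cpoly"
  where "mi_deriv \<alpha> P =
    Finite_Set.fold (\<lambda>i. partial_deriv i ^^ Poly_Mapping.lookup \<alpha> i) P UNIV"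

definition poly_norm :: "('n cpoly \<Rightarrow> real) \<Rightarrow> bool"
  where "poly_norm q \<longleftrightarrow>
    (\<forall>P. 0 \<le> q P) \<and>
    (\<forall>P. q P = 0 \<longleftrightarrow> P = 0) \<and>
    (\<forall>c P. q (const_poly c * P) = norm c * q P) \<and>
    (\<forall>P Q. q (P + Q) \<le> q P + q Q)"

definition admissible_norm :: "(complex ^ 'n::finite) set \<Rightarrow> ('n cpoly \<Rightarrow> real) \<Rightarrow> bool"
  where "admissible_norm E q \<longleftrightarrow> poly_norm q \<and>
    (\<exists>A B a b :: real. A > 0 \<and> B > 0 \<and> a \<ge> 0 \<and> b \<ge> 0 \<and>
      (\<forall>P. total_deg P \<ge> 1 \<longrightarrow>
         sup_norm E P \<le> A * real (total_deg P) powr a * q P \<and>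
         q P \<le> B * real (total_deg P) powr b * sup_norm E P))"

text \<open>
  The exponents are extended reals, so that \<open>Inf {} = \<infinity>\<close>. They are defined for arbitrary
  functionals \<open>q\<close>, so that they also apply to \<open>sup_norm E\<close>.
\<close>

definition markov_mi :: "'n::finite multi_index \<Rightarrow> ('n cpoly \<Rightarrow> real) \<Rightarrow> ereal"
  where "markov_mi \<alpha> q =
    Inf (ereal ` {s. s > 0 \<and>
      (\<exists>M>0. \<forall>P. q (mi_deriv \<alpha> P) \<le> M * real (total_deg P) powr s * q P)})"

definition markov_ord :: "nat \<Rightarrow> ('n::finite cpoly \<Rightarrow> real) \<Rightarrow> ereal"
  where "markov_ord k q = Max ((\<lambda>\<alpha>. markov_mi \<alpha> q) ` {\<alpha>. mi_size \<alpha> = k})"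

definition markov_exponent :: "('n::finite cpoly \<Rightarrow> real) \<Rightarrow> ereal"
  where "markov_exponent q = markov_ord 1 q"

definition asymptotic_exponent :: "('n::finite cpoly \<Rightarrow> real) \<Rightarrow> ereal"
  where "asymptotic_exponent q = limsup (\<lambda>k. markov_ord k q / ereal (real k))"

definition markov_exponent_set :: "(complex ^ 'n::finite) set \<Rightarrow> ereal"
  where "markov_exponent_set E = markov_exponent (sup_norm E)"


text \<open>The maximum in \<^const>\<open>markov_ord\<close> is over a finite nonempty set.\<close>

lemma finite_mi_size: "finite {\<alpha> :: 'n::finite multi_index. mi_size \<alpha> = k}"
proof -
  have le: "Poly_Mapping.lookup \<alpha> i \<le> mi_size \<alpha>" for \<alpha> :: "'n multi_index" and i
    unfolding mi_size_def by (rule member_le_sum) simp_all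
  have "Poly_Mapping.lookup ` {\<alpha> :: 'n multi_index. mi_size \<alpha> = k} \<subseteq> PiE UNIV (\<lambda>_. {..k})"
    using le by (fastforce simp: PiE_UNIV_domain)
  moreover have "finite (PiE (UNIV :: 'n set) (\<lambda>_. {..k}))"
    by (intro finite_PiE) auto
  moreover have "inj_on Poly_Mapping.lookup {\<alpha> :: 'n multi_index. mi_size \<alpha> = k}"
    by (simp add: inj_on_def poly_mapping.lookup_inject)
  ultimately show ?thesis
    by (rule finite_imageD[OF finite_subset])
qed

lemma mi_size_single: "mi_size (Poly_Mapping.single i k) = k"
  by (simp add: mi_size_def lookup_single when_def)

lemma nonempty_mi_size: "{\<alpha> :: 'n::finite multi_index. mi_size \<alpha> = k} \<noteq> {}"
  using mi_size_single by blast

lemma lookup_partial_deriv: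
  "Poly_Mapping.lookup (partial_deriv i P) \<gamma> =
     of_nat (Poly_Mapping.lookup \<gamma> i + 1) *
     Poly_Mapping.lookup P (\<gamma> + Poly_Mapping.single i 1)"
proof -
  let ?e = "Poly_Mapping.single i (1::nat)"
  have eq: "Poly_Mapping.lookup (Poly_Mapping.single (\<beta> - ?e)
         (of_nat (Poly_Mapping.lookup \<beta> i) * Poly_Mapping.lookup P \<beta>)) \<gamma>
      = (if \<beta> = \<gamma> + ?e then of_nat (Poly_Mapping.lookup \<beta> i) * Poly_Mapping.lookup P \<beta> else 0)"
    for \<beta>
  proof (cases "Poly_Mapping.lookup \<beta> i = 0")
    case True
    then show ?thesis by (auto simp: lookup_add)
  next
    case False
    then have "\<beta> - ?e + ?e = \<beta>"
      by (intro poly_mapping_eqI) (auto simp: lookup_add lookup_minus lookup_single when_def)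
    then have "\<beta> - ?e = \<gamma> \<longleftrightarrow> \<beta> = \<gamma> + ?e"
      by (metis add_diff_cancel_right')
    then show ?thesis by (auto simp: lookup_single when_def)
  qed
  show ?thesis
    unfolding partial_deriv_def lookup_sum eq
    by (auto simp: sum.delta lookup_add lookup_single in_keys_iff)
qed

lemma partial_deriv_commute:
  "partial_deriv i (partial_deriv j P) = partial_deriv j (partial_deriv i P)"
proof (cases "i = j")
  case False
  have "\<gamma> + Poly_Mapping.single i (1::nat) + Poly_Mapping.single j 1 =
      \<gamma> + Poly_Mapping.single j 1 + Poly_Mapping.single i 1" for \<gamma>
    by (simp only: add.assoc add.commute[of "Poly_Mapping.single i (1::nat)"])
  then show ?thesis
    using False
    by (intro poly_mapping_eqI) (simp add: lookup_partial_deriv lookup_add lookup_single)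
qed simp

lemma comp_fun_commute_partial_deriv:
  "comp_fun_commute (\<lambda>i. partial_deriv i ^^ Poly_Mapping.lookup \<alpha> i)"
proof
  fix i j :: 'a
  have 1: "(partial_deriv i ^^ m) (partial_deriv j P) = partial_deriv j ((partial_deriv i ^^ m) P)"
    for m P by (induction m) (simp_all add: partial_deriv_commute)
  have "(partial_deriv i ^^ m) ((partial_deriv j ^^ n) P) = (partial_deriv j ^^ n) ((partial_deriv i ^^ m) P)"
    for m n P by (induction n) (simp_all add: 1)
  then show "(partial_deriv j ^^ Poly_Mapping.lookup \<alpha> j) \<circ> (partial_deriv i ^^ Poly_Mapping.lookup \<alpha> i)
      = (partial_deriv i ^^ Poly_Mapping.lookup \<alpha> i) \<circ> (partial_deriv j ^^ Poly_Mapping.lookup \<alpha> j)"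
    by (simp add: fun_eq_iff)
qed

text \<open>The formal partial derivative is the analytic one.\<close>

lemma eval_poly_superset:
  assumes "finite K" "Poly_Mapping.keys P \<subseteq> K"
  shows "eval_poly P x =
    (\<Sum>\<beta>\<in>K. Poly_Mapping.lookup P \<beta> * (\<Prod>i\<in>UNIV. (x $ i) ^ Poly_Mapping.lookup \<beta> i))"
  unfolding eval_poly_def
  by (rule sum.mono_neutral_left) (use assms in \<open>auto simp: in_keys_iff\<close>)

lemma eval_poly_add: "eval_poly (P + Q) x = eval_poly P x + eval_poly Q x"
proof -
  let ?K = "Poly_Mapping.keys P \<union> Poly_Mapping.keys Q"
  have "Poly_Mapping.keys (P + Q) \<subseteq> ?K" by (rule keys_add)
  then show ?thesis
    by (simp add: eval_poly_superset[of ?K] lookup_add sum.distrib distrib_right)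
qed

lemma eval_poly_sum: "eval_poly (sum f A) x = (\<Sum>a\<in>A. eval_poly (f a) x)"
  by (induction A rule: infinite_finite_induct) (simp_all add: eval_poly_add, simp_all add: eval_poly_def)

lemma eval_poly_single:
  "eval_poly (Poly_Mapping.single \<beta> c) x = c * (\<Prod>i\<in>UNIV. (x $ i) ^ Poly_Mapping.lookup \<beta> i)"
  by (simp add: eval_poly_def)

lemma has_field_derivative_partial_deriv:
  "((\<lambda>t. eval_poly P (x + axis i t)) has_field_derivative
     eval_poly (partial_deriv i P) (x + axis i t)) (at t)"
proof -
  let ?r = "\<lambda>\<beta>. \<Prod>j\<in>UNIV - {i}. (x $ j) ^ Poly_Mapping.lookup \<beta> j"
  have split: "(\<Prod>j\<in>UNIV. ((x + axis i t) $ j) ^ Poly_Mapping.lookup \<beta> j)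
      = (x $ i + t) ^ Poly_Mapping.lookup \<beta> i * ?r \<beta>" for \<beta> t
    by (subst prod.remove[of _ i]) (auto simp: axis_def intro!: prod.cong)
  have r: "?r (\<beta> - Poly_Mapping.single i 1) = ?r \<beta>" for \<beta>
    by (intro prod.cong) (auto simp: lookup_minus lookup_single when_def)
  have "eval_poly (partial_deriv i P) (x + axis i t) =
      (\<Sum>\<beta>\<in>Poly_Mapping.keys P. Poly_Mapping.lookup P \<beta> *
        (of_nat (Poly_Mapping.lookup \<beta> i) * (x $ i + t) ^ (Poly_Mapping.lookup \<beta> i - 1) * ?r \<beta>))"
    unfolding partial_deriv_def eval_poly_sum eval_poly_single split r
    by (simp add: lookup_minus mult_ac)
  moreover have "((\<lambda>t. \<Sum>\<beta>\<in>Poly_Mapping.keys P. Poly_Mapping.lookup P \<beta> *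
        ((x $ i + t) ^ Poly_Mapping.lookup \<beta> i * ?r \<beta>)) has_field_derivative
      (\<Sum>\<beta>\<in>Poly_Mapping.keys P. Poly_Mapping.lookup P \<beta> *
        (of_nat (Poly_Mapping.lookup \<beta> i) * (x $ i + t) ^ (Poly_Mapping.lookup \<beta> i - 1) * ?r \<beta>))) (at t)"
  proof (rule DERIV_sum)
    fix \<beta>
    have "((\<lambda>t. (x $ i + t) ^ Poly_Mapping.lookup \<beta> i) has_field_derivative
        of_nat (Poly_Mapping.lookup \<beta> i) * (x $ i + t) ^ (Poly_Mapping.lookup \<beta> i - 1)) (at t)"
      by (auto intro!: derivative_eq_intros)
    from DERIV_cmult[OF DERIV_cmult_right[OF this]]
    show "((\<lambda>t. Poly_Mapping.lookup P \<beta> * ((x $ i + t) ^ Poly_Mapping.lookup \<beta> i * ?r \<beta>))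
        has_field_derivative Poly_Mapping.lookup P \<beta> *
        (of_nat (Poly_Mapping.lookup \<beta> i) * (x $ i + t) ^ (Poly_Mapping.lookup \<beta> i - 1) * ?r \<beta>)) (at t)" .
  qed
  ultimately show ?thesis
    unfolding eval_poly_def[of P] split by simp
qed

end

theory Submission
  imports Defs
begin

text \<open>
  The factors in Nikolskii's property are powers of the degree, with exponents \<open>a\<close> and \<open>b\<close> that do
  not depend on how many derivatives are taken. Passing from \<open>q\<close> to the supremum norm on \<open>E\<close> and
  back therefore moves \<open>m\<^sub>k(q)\<close> by at most \<open>a + b\<close> (\<open>markov_ord_le_comparison\<close>), an error that
  disappears after division by \<open>k\<close>. It remains to see that the supremum norm satisfies
  \<open>m\<^sub>k(E) = k m(E)\<close> for every \<open>k \<ge> 1\<close>.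

  The bound \<open>m\<^sub>k \<le> k m\<^sub>1\<close> holds for any norm: iterate the first order inequality
  (\<open>markov_ord_le_iterate\<close>). Applied to \<open>q\<close> itself it also gives \<open>m(E) \<le> m(q)\<close> in the limit.

  The converse uses that the supremum norm is multiplicative on powers. For \<open>x \<in> E\<close> the
  polynomial \<open>(P - P(x))\<^sup>k\<close> vanishes at \<open>x\<close> to order \<open>k\<close>, so its \<open>k\<close>-th derivative in the direction
  \<open>i\<close> at \<open>x\<close> is \<open>k! (\<partial>\<^sub>i P(x))\<^sup>k\<close>. An inequality for \<open>\<partial>\<^sub>i\<^sup>k\<close> with exponent \<open>s\<close> thus bounds
  \<open>|\<partial>\<^sub>i P(x)|\<^sup>k\<close>, and taking \<open>k\<close>-th roots gives an inequality for \<open>\<partial>\<^sub>i\<close> with exponent \<open>s / k\<close>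
  (\<open>norm_partial_deriv_power_le\<close>).
\<close>

section \<open>Polynomials: evaluation, degree and iterated derivatives\<close>

lemma sum_single_lookup: "(\<Sum>\<beta>\<in>Poly_Mapping.keys P. Poly_Mapping.single \<beta> (Poly_Mapping.lookup P \<beta>)) = P"
  by (rule poly_mapping_eqI) (auto simp: lookup_sum lookup_single when_def in_keys_iff)

lemma eval_poly_mult: "eval_poly (P * Q) x = eval_poly P x * eval_poly Q x"
proof -
  have "P * Q = (\<Sum>\<beta>\<in>Poly_Mapping.keys P. \<Sum>\<gamma>\<in>Poly_Mapping.keys Q.
      Poly_Mapping.single \<beta> (Poly_Mapping.lookup P \<beta>) * Poly_Mapping.single \<gamma> (Poly_Mapping.lookup Q \<gamma>))"
    by (subst (1 2) sum_single_lookup[symmetric]) (rule sum_product)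
  then show ?thesis
    by (simp add: eval_poly_sum mult_single eval_poly_single lookup_add power_add prod.distrib
        eval_poly_def[of P] eval_poly_def[of Q] sum_product mult_ac)
qed

lemma eval_poly_const: "eval_poly (const_poly c) x = c"
  by (simp add: const_poly_def eval_poly_single)

lemma eval_poly_zero: "eval_poly 0 x = 0"
  by (simp add: eval_poly_def)

lemma eval_poly_power: "eval_poly (P ^ n) x = eval_poly P x ^ n"
  using eval_poly_const[of 1 x] by (induction n) (simp_all add: eval_poly_mult const_poly_def)

lemma continuous_on_eval_poly: "continuous_on E (eval_poly P)"
  unfolding eval_poly_def by (intro continuous_intros)

lemma mi_size_add: "mi_size (\<alpha> + \<beta>) = mi_size \<alpha> + mi_size \<beta>"
  by (simp add: mi_size_def lookup_add sum.distrib)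

lemma total_deg_le_iff: "total_deg P \<le> n \<longleftrightarrow> (\<forall>\<beta>\<in>Poly_Mapping.keys P. mi_size \<beta> \<le> n)"
  by (simp add: total_deg_def)

lemma mi_size_le_total_deg: "\<beta> \<in> Poly_Mapping.keys P \<Longrightarrow> mi_size \<beta> \<le> total_deg P"
  using total_deg_le_iff[of P "total_deg P"] by simp

lemma total_deg_const_poly: "total_deg (const_poly c) = 0"
  by (simp add: total_deg_def const_poly_def mi_size_def)

lemma total_deg_add: "total_deg (P + Q) \<le> max (total_deg P) (total_deg Q)"
  unfolding total_deg_le_iff
  using keys_add[of P Q] mi_size_le_total_deg[of _ P] mi_size_le_total_deg[of _ Q]
  by (fastforce simp: le_max_iff_disj)

lemma total_deg_mult: "total_deg (P * Q) \<le> total_deg P + total_deg Q"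
  unfolding total_deg_le_iff
proof
  fix \<beta> assume "\<beta> \<in> Poly_Mapping.keys (P * Q)"
  then obtain a b where "\<beta> = a + b" "a \<in> Poly_Mapping.keys P" "b \<in> Poly_Mapping.keys Q"
    using keys_mult[of P Q] by auto
  then show "mi_size \<beta> \<le> total_deg P + total_deg Q"
    by (simp add: mi_size_add add_mono mi_size_le_total_deg)
qed

lemma total_deg_power: "total_deg (P ^ n) \<le> n * total_deg P"
proof (induction n)
  case 0
  then show ?case using total_deg_const_poly[of 1] by (simp add: const_poly_def)
next
  case (Suc n)
  then show ?case using total_deg_mult[of P "P ^ n"] by simp
qed

lemma total_deg_0_imp_const:
  assumes "total_deg P = 0"
  shows "P = const_poly (Poly_Mapping.lookup P 0)"
proof (rule poly_mapping_eqI)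
  fix \<beta> :: "'a multi_index"
  show "Poly_Mapping.lookup P \<beta> = Poly_Mapping.lookup (const_poly (Poly_Mapping.lookup P 0)) \<beta>"
  proof (cases "\<beta> = 0")
    case False
    then have "mi_size \<beta> \<noteq> 0"
      by (auto simp: mi_size_def poly_mapping_eq_iff fun_eq_iff)
    then have "\<beta> \<notin> Poly_Mapping.keys P"
      using mi_size_le_total_deg[of \<beta> P] assms by auto
    with False show ?thesis
      by (simp add: const_poly_def lookup_single when_def in_keys_iff)
  qed (simp add: const_poly_def)
qed

lemma total_deg_partial_deriv: "total_deg (partial_deriv i P) \<le> total_deg P"
  unfolding total_deg_le_iff
proof
  fix \<gamma> assume "\<gamma> \<in> Poly_Mapping.keys (partial_deriv i P)"
  then have "\<gamma> + Poly_Mapping.single i 1 \<in> Poly_Mapping.keys P"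
    by (auto simp: in_keys_iff lookup_partial_deriv)
  from mi_size_le_total_deg[OF this] show "mi_size \<gamma> \<le> total_deg P"
    by (simp add: mi_size_add)
qed

lemma partial_deriv_eq_0:
  assumes "total_deg P = 0"
  shows "partial_deriv i P = 0"
proof (rule poly_mapping_eqI)
  fix \<gamma>
  have "\<gamma> + Poly_Mapping.single i 1 \<notin> Poly_Mapping.keys P"
    using mi_size_le_total_deg[of "\<gamma> + Poly_Mapping.single i 1" P] assms
    by (auto simp: mi_size_add mi_size_single)
  then show "Poly_Mapping.lookup (partial_deriv i P) \<gamma> = Poly_Mapping.lookup 0 \<gamma>"
    by (simp add: lookup_partial_deriv in_keys_iff)
qed

text \<open>
  Writing \<open>D\<^sup>\<alpha>\<close> as a list of \<open>|\<alpha>|\<close> directions replaces the fold over the variables by list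
  induction.
\<close>

lemma mi_deriv_as_foldr:
  obtains ds where "length ds = mi_size \<alpha>" "set ds \<subseteq> Poly_Mapping.keys \<alpha>"
    "\<And>P. mi_deriv \<alpha> P = foldr partial_deriv ds P"
proof -
  let ?f = "\<lambda>i. partial_deriv i ^^ Poly_Mapping.lookup \<alpha> i"
  interpret comp_fun_commute ?f
    by (rule comp_fun_commute_partial_deriv)
  have "\<exists>ds. length ds = sum (Poly_Mapping.lookup \<alpha>) F \<and> set ds \<subseteq> Poly_Mapping.keys \<alpha> \<and>
      (\<forall>P. Finite_Set.fold ?f P F = foldr partial_deriv ds P)" if "finite F" for F
    using that
  proof (induction F)
    case (insert i F)
    then obtain ds where ds: "length ds = sum (Poly_Mapping.lookup \<alpha>) F"
      "set ds \<subseteq> Poly_Mapping.keys \<alpha>" "\<And>P. Finite_Set.fold ?f P F = foldr partial_deriv ds P"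
      by blast
    have "foldr partial_deriv (replicate k i) P = (partial_deriv i ^^ k) P" for k P
      by (induction k) simp_all
    with insert ds show ?case
      by (intro exI[of _ "replicate (Poly_Mapping.lookup \<alpha> i) i @ ds"])
        (auto simp: in_keys_iff)
  qed simp
  from this[of UNIV] show ?thesis
    by (auto simp: mi_size_def mi_deriv_def intro: that)
qed

lemma mi_deriv_single: "mi_deriv (Poly_Mapping.single i k) P = (partial_deriv i ^^ k) P"
proof -
  obtain ds where ds: "length ds = mi_size (Poly_Mapping.single i k)"
    "set ds \<subseteq> Poly_Mapping.keys (Poly_Mapping.single i k)"
    "\<And>P. mi_deriv (Poly_Mapping.single i k) P = foldr partial_deriv ds P"
    using mi_deriv_as_foldr by blast
  have "ds = replicate k i"
    using ds(1,2) by (intro replicate_eqI) (auto simp: mi_size_single split: if_splits)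
  moreover have "foldr partial_deriv (replicate k i) P = (partial_deriv i ^^ k) P" for k P
    by (induction k) simp_all
  ultimately show ?thesis
    using ds(3) by simp
qed

lemma mi_deriv_size_1:
  assumes "mi_size \<alpha> = 1"
  obtains i where "\<And>P. mi_deriv \<alpha> P = partial_deriv i P"
proof -
  obtain ds where ds: "length ds = mi_size \<alpha>" "\<And>P. mi_deriv \<alpha> P = foldr partial_deriv ds P"
    using mi_deriv_as_foldr by blast
  then obtain i where "ds = [i]"
    using assms by (auto simp: length_Suc_conv)
  with ds(2) show ?thesis
    by (intro that[of i]) simp
qed

lemma total_deg_foldr_partial_deriv: "total_deg (foldr partial_deriv ds P) \<le> total_deg P"
  by (induction ds) (auto intro: order_trans[OF total_deg_partial_deriv])

lemma total_deg_mi_deriv: "total_deg (mi_deriv \<alpha> P) \<le> total_deg P"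
  by (metis mi_deriv_as_foldr total_deg_foldr_partial_deriv)

lemma mi_deriv_eq_0:
  assumes "total_deg P = 0" "mi_size \<alpha> > 0"
  shows "mi_deriv \<alpha> P = 0"
proof -
  obtain ds where ds: "length ds = mi_size \<alpha>" "\<And>P. mi_deriv \<alpha> P = foldr partial_deriv ds P"
    using mi_deriv_as_foldr by blast
  then obtain i js where "ds = i # js"
    using assms(2) by (cases ds) auto
  with ds(2) show ?thesis
    using total_deg_foldr_partial_deriv[of js P] assms(1) by (simp add: partial_deriv_eq_0)
qed

section \<open>Powers of a polynomial vanishing at a point\<close>

lemma eval_partial_deriv:
  "((\<lambda>t. eval_poly P (y + axis i t)) has_field_derivative eval_poly (partial_deriv i P) y) (at 0)"
proof -
  have [simp]: "axis i 0 = (0 :: complex ^ 'a)"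
    by (simp add: axis_eq_0_iff)
  show ?thesis
    using has_field_derivative_partial_deriv[of P y i 0] by simp
qed

lemma eval_partial_deriv_mult_power:
  assumes "\<And>y. eval_poly Q y = eval_poly R y * eval_poly G y ^ Suc n"
  shows "eval_poly (partial_deriv i Q) y =
    eval_poly (partial_deriv i R * G + const_poly (of_nat (Suc n)) * R * partial_deriv i G) y *
      eval_poly G y ^ n"
proof -
  have [simp]: "axis i 0 = (0 :: complex ^ 'a)"
    by (simp add: axis_eq_0_iff)
  have "((\<lambda>t. eval_poly R (y + axis i t) * eval_poly G (y + axis i t) ^ Suc n) has_field_derivative
      eval_poly (partial_deriv i R) y * eval_poly G y ^ Suc n +
      of_nat (Suc n) * eval_poly (partial_deriv i G) y * eval_poly G y ^ n * eval_poly R y) (at 0)"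
    using DERIV_mult[OF eval_partial_deriv DERIV_power[OF eval_partial_deriv], of R y i G y i "Suc n"]
    by (simp add: algebra_simps)
  moreover have "((\<lambda>t. eval_poly R (y + axis i t) * eval_poly G (y + axis i t) ^ Suc n)
      has_field_derivative eval_poly (partial_deriv i Q) y) (at 0)"
    using eval_partial_deriv[of Q y i] by (simp only: assms)
  ultimately have "eval_poly (partial_deriv i Q) y =
      eval_poly (partial_deriv i R) y * eval_poly G y ^ Suc n +
      of_nat (Suc n) * eval_poly (partial_deriv i G) y * eval_poly G y ^ n * eval_poly R y"
    by (rule DERIV_unique[symmetric])
  then show ?thesis
    by (simp add: eval_poly_add eval_poly_mult eval_poly_const algebra_simps)
qed

text \<open>
  At a zero of \<open>G\<close> only the term of \<open>\<partial>\<^sub>i\<^sup>n (R G\<^sup>n)\<close> in which every derivative meets a different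
  factor \<open>G\<close> survives. The cofactor \<open>R\<close> makes the induction work: the derivative of
  \<open>R G\<^bsup>n+1\<^esup>\<close> is again a cofactor times \<open>G\<^sup>n\<close>.
\<close>

lemma eval_iterated_partial_deriv_mult_power:
  assumes "eval_poly G x = 0" "\<And>y. eval_poly Q y = eval_poly R y * eval_poly G y ^ n"
  shows "eval_poly ((partial_deriv i ^^ n) Q) x =
    fact n * eval_poly R x * eval_poly (partial_deriv i G) x ^ n"
  using assms(2)
proof (induction n arbitrary: Q R)
  case (Suc n)
  have "eval_poly ((partial_deriv i ^^ n) (partial_deriv i Q)) x = fact n *
      eval_poly (partial_deriv i R * G + const_poly (of_nat (Suc n)) * R * partial_deriv i G) x *
      eval_poly (partial_deriv i G) x ^ n"
    by (rule Suc.IH) (rule eval_partial_deriv_mult_power[OF Suc.prems])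
  then show ?case
    using assms(1)
    by (simp add: funpow_swap1 eval_poly_add eval_poly_mult eval_poly_const algebra_simps)
qed simp

section \<open>The supremum norm\<close>

lemma norm_eval_le_sup_norm:
  assumes "compact E" "x \<in> E"
  shows "norm (eval_poly P x) \<le> sup_norm E P"
proof -
  have "compact ((\<lambda>x. norm (eval_poly P x)) ` E)"
    by (intro compact_continuous_image continuous_intros continuous_on_eval_poly assms)
  then have "bdd_above ((\<lambda>x. norm (eval_poly P x)) ` E)"
    by (intro bounded_imp_bdd_above compact_imp_bounded)
  then show ?thesis
    unfolding sup_norm_def using assms(2) by (rule cSUP_upper2) simp
qed

lemma sup_norm_le:
  assumes "E \<noteq> {}" "\<And>x. x \<in> E \<Longrightarrow> norm (eval_poly P x) \<le> c"
  shows "sup_norm E P \<le> c"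
  unfolding sup_norm_def using assms by (rule cSUP_least)

lemma sup_norm_const_poly: "E \<noteq> {} \<Longrightarrow> sup_norm E (const_poly c) = norm c"
  by (simp add: sup_norm_def eval_poly_const)

lemma sup_norm_const_mult_le:
  assumes "compact E" "E \<noteq> {}"
  shows "sup_norm E (const_poly c * P) \<le> norm c * sup_norm E P"
  using assms
  by (intro sup_norm_le)
    (auto simp: eval_poly_mult eval_poly_const norm_mult intro!: mult_left_mono norm_eval_le_sup_norm)

lemma poly_norm_const:
  assumes "poly_norm q"
  shows "q (const_poly c) = norm c * q 1" "q 1 > 0" "q 0 = 0" "q P \<ge> 0"
proof -
  have "q (const_poly c * 1) = norm c * q 1"
    using assms unfolding poly_norm_def by blast
  then show "q (const_poly c) = norm c * q 1"
    by simp
  have "q 1 \<noteq> 0" "q 1 \<ge> 0"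
    using assms one_neq_zero unfolding poly_norm_def by blast+
  then show "q 1 > 0"
    by simp
  show "q 0 = 0" "q P \<ge> 0"
    using assms unfolding poly_norm_def by blast+
qed

text \<open>
  Over the empty set the supremum would be one and the same (unspecified) number for all polynomials,
  and Nikolskii's property would bound \<open>q\<close> on all nonzero multiples of a variable, which have degree
  \<open>1\<close>. No norm is bounded there.
\<close>

lemma admissible_norm_imp_nonempty:
  fixes E :: "(complex ^ 'n::finite) set"
  assumes "admissible_norm E q"
  shows "E \<noteq> {}"
proof
  assume "E = {}"
  then have const: "sup_norm E P = sup_norm E 0" for P
    by (simp add: sup_norm_def)
  from assms obtain B b where q: "poly_norm q"
    and B: "\<And>P. total_deg P \<ge> 1 \<Longrightarrow> q P \<le> B * real (total_deg P) powr b * sup_norm E P"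
    unfolding admissible_norm_def by blast
  obtain i :: 'n where True
    by simp
  define X :: "complex \<Rightarrow> 'n cpoly"
    where "X = (\<lambda>c. Poly_Mapping.single (Poly_Mapping.single i 1) c)"
  have deg: "total_deg (X c) = 1" if "c \<noteq> 0" for c
    using that by (simp add: X_def total_deg_def mi_size_single)
  have X: "q (X c) = norm c * q (X 1)" for c
  proof -
    have "X c = const_poly c * X 1"
      by (simp add: X_def const_poly_def mult_single)
    then show ?thesis
      using q unfolding poly_norm_def by metis
  qed
  have "X 1 \<noteq> 0"
    using deg[of 1] by (auto simp: total_deg_def)
  then have pos: "q (X 1) > 0"
    using q unfolding poly_norm_def by (metis less_eq_real_def)
  \<comment> \<open>The multiple of the variable is chosen so that \<open>q\<close> exceeds the alleged bound by \<open>q (X 1)\<close>.\<close>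
  define t where "t = \<bar>B * sup_norm E 0\<bar> / q (X 1) + 1"
  have "t > 0"
    using pos by (auto simp: t_def intro: add_nonneg_pos)
  then have "t * q (X 1) \<le> B * sup_norm E 0"
    using B[of "X (of_real t)"] deg[of "of_real t"] X[of "of_real t"] const[of "X (of_real t)"]
    by simp
  moreover have "t * q (X 1) = \<bar>B * sup_norm E 0\<bar> + q (X 1)"
    using pos by (simp add: t_def field_simps)
  ultimately show False
    using pos by linarith
qed

text \<open>
  Definiteness is where admissibility enters: \<open>q\<close> bounds the supremum norm from below on nonconstant
  polynomials. Hence \<open>E\<close> lies in no algebraic hypersurface.
\<close>

lemma poly_norm_sup_norm:
  assumes E: "compact E" and adm: "admissible_norm E q"
  shows "poly_norm (sup_norm E)"
proof -
  have ne: "E \<noteq> {}"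
    using adm by (rule admissible_norm_imp_nonempty)
  then obtain x where x: "x \<in> E"
    by blast
  have nonneg: "0 \<le> sup_norm E P" for P
    using norm_eval_le_sup_norm[OF E x, of P] norm_ge_zero order_trans by blast
  have zero: "sup_norm E P = 0 \<longleftrightarrow> P = 0" for P
  proof
    assume "P = 0"
    then show "sup_norm E P = 0"
      using ne by (simp add: sup_norm_def eval_poly_zero)
  next
    assume 0: "sup_norm E P = 0"
    show "P = 0"
    proof (cases "total_deg P = 0")
      case True
      from total_deg_0_imp_const[OF this] have P: "P = const_poly (Poly_Mapping.lookup P 0)" .
      with 0 have "norm (Poly_Mapping.lookup P 0) = 0"
        using sup_norm_const_poly[OF ne] by metis
      with P show ?thesis
        by (simp add: const_poly_def)
    next
      case False
      with adm 0 have "q P \<le> 0" and q: "poly_norm q"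
        unfolding admissible_norm_def by (auto dest!: spec[of _ P] simp: Suc_le_eq)
      then show ?thesis
        unfolding poly_norm_def by (metis order_antisym)
    qed
  qed
  have scale: "sup_norm E (const_poly c * P) = norm c * sup_norm E P" for c P
  proof (cases "c = 0")
    case True
    then show ?thesis
      using zero by (simp add: const_poly_def)
  next
    case False
    have "P = const_poly (inverse c) * (const_poly c * P)"
      using False by (simp add: const_poly_def mult_single flip: mult.assoc)
    then have "sup_norm E P \<le> norm (inverse c) * sup_norm E (const_poly c * P)"
      using sup_norm_const_mult_le[OF E ne] by metis
    then have "norm c * sup_norm E P \<le> sup_norm E (const_poly c * P)"
      using False by (simp add: norm_divide field_simps)
    with sup_norm_const_mult_le[OF E ne, of c P] show ?thesis
      by (rule order_antisym)
  qed
  have "sup_norm E (P + Q) \<le> sup_norm E P + sup_norm E Q" for P Q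
    using E ne
    by (intro sup_norm_le)
      (auto simp: eval_poly_add intro!: order_trans[OF norm_triangle_ineq] add_mono norm_eval_le_sup_norm)
  with nonneg zero scale show ?thesis
    unfolding poly_norm_def by blast
qed

section \<open>Markov exponents as infima of valid exponents\<close>

definition markov_bound :: "'n::finite multi_index \<Rightarrow> ('n cpoly \<Rightarrow> real) \<Rightarrow> real \<Rightarrow> bool"
  where "markov_bound \<alpha> q s \<longleftrightarrow> s > 0 \<and>
    (\<exists>M>0. \<forall>P. q (mi_deriv \<alpha> P) \<le> M * real (total_deg P) powr s * q P)"

lemma markov_mi_le: "markov_bound \<alpha> q s \<Longrightarrow> markov_mi \<alpha> q \<le> ereal s"
  unfolding markov_mi_def markov_bound_def by (intro Inf_lower) auto

lemma markov_mi_nonneg: "markov_mi \<alpha> q \<ge> 0"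
  unfolding markov_mi_def by (intro Inf_greatest) auto

text \<open>
  With the convention \<open>0 powr s = 0\<close> monotonicity in the exponent holds for every degree, including
  \<open>0\<close>; the valid exponents therefore form an upward closed set.
\<close>

lemma of_nat_powr_mono: "s \<le> r \<Longrightarrow> real n powr s \<le> real n powr r"
  by (cases "n = 0") (auto intro: powr_mono)

lemma markov_bound_if_gt:
  assumes "poly_norm q" "markov_mi \<alpha> q < ereal r"
  shows "markov_bound \<alpha> q r"
proof -
  from assms(2) obtain s M where s: "s > 0" "s < r" "M > 0"
    and M: "\<And>P. q (mi_deriv \<alpha> P) \<le> M * real (total_deg P) powr s * q P"
    unfolding markov_mi_def Inf_less_iff by auto
  have "q (mi_deriv \<alpha> P) \<le> M * real (total_deg P) powr r * q P" for P
    using M[of P] s poly_norm_const(4)[OF assms(1), of P]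
    by (elim order_trans) (intro mult_right_mono mult_left_mono of_nat_powr_mono; simp)
  with s show ?thesis
    unfolding markov_bound_def by (auto intro!: exI[of _ M])
qed

lemma markov_mi_le_markov_ord: "mi_size \<alpha> = k \<Longrightarrow> markov_mi \<alpha> q \<le> markov_ord k q"
  unfolding markov_ord_def by (intro Max_ge) (auto intro: finite_mi_size)

lemma markov_ord_le:
  assumes "\<And>\<alpha>. mi_size \<alpha> = k \<Longrightarrow> markov_mi \<alpha> q \<le> x"
  shows "markov_ord k q \<le> x"
  unfolding markov_ord_def using assms nonempty_mi_size
  by (intro Max.boundedI) (auto intro: finite_mi_size)

lemma markov_ord_nonneg: "markov_ord k (q :: 'n::finite cpoly \<Rightarrow> real) \<ge> 0"
proof -
  obtain \<alpha> :: "'n multi_index" where "mi_size \<alpha> = k"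
    using nonempty_mi_size by blast
  then show ?thesis
    using markov_mi_le_markov_ord markov_mi_nonneg order_trans by blast
qed

text \<open>
  Comparisons of exponents are proved by testing real upper bounds, so that an infinite exponent,
  which has none, needs no separate treatment.
\<close>

lemma ereal_le_if_real_above:
  fixes x y :: ereal
  assumes "\<And>r. y < ereal r \<Longrightarrow> x \<le> ereal r"
  shows "x \<le> y"
proof (rule dense_ge)
  fix z assume "y < z"
  with assms show "x \<le> z"
    by (cases z) auto
qed

lemma ereal_divide_of_nat:
  assumes "k > 0"
  shows "x / ereal (real k) \<le> ereal r \<longleftrightarrow> x \<le> ereal (real k * r)"
    and "x / ereal (real k) < ereal r \<longleftrightarrow> x < ereal (real k * r)"
  using assms by (cases x; simp add: field_simps)+

section \<open>The exponents of order \<open>k\<close>\<close>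

text \<open>
  Derivatives do not raise the degree, so first order inequalities can be chained \<open>k\<close> times.
\<close>

lemma markov_ord_le_iterate:
  fixes q :: "'n::finite cpoly \<Rightarrow> real"
  assumes q: "poly_norm q" and k: "k > 0"
  shows "markov_ord k q / ereal (real k) \<le> markov_exponent q"
proof (rule ereal_le_if_real_above)
  fix r assume r: "markov_exponent q < ereal r"
  have first: "markov_bound (Poly_Mapping.single i 1) q r" for i
    using markov_mi_le_markov_ord[OF mi_size_single, of i 1 q] r q
    by (intro markov_bound_if_gt) (auto simp: markov_exponent_def)
  then have "r > 0"
    by (simp add: markov_bound_def)
  from first have "\<forall>i. \<exists>M>0. \<forall>P. q (partial_deriv i P) \<le> M * real (total_deg P) powr r * q P"
    by (simp add: markov_bound_def mi_deriv_single)
  then obtain M where M: "\<And>i. M i > 0"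
    "\<And>i P. q (partial_deriv i P) \<le> M i * real (total_deg P) powr r * q P"
    by metis
  define C where "C = sum M UNIV"
  have MC: "M i \<le> C" for i
    unfolding C_def using M(1) by (intro member_le_sum) (auto intro: less_imp_le)
  have "C > 0"
    using M(1) MC order.strict_trans2 by blast
  have step: "q (partial_deriv i P) \<le> C * real n powr r * q P" if "total_deg P \<le> n" for i P n
  proof -
    have "real (total_deg P) powr r \<le> real n powr r"
      using that \<open>r > 0\<close> by (intro powr_mono2) auto
    then show ?thesis
      using M(1)[of i] MC[of i] poly_norm_const(4)[OF q, of P]
      by (intro order_trans[OF M(2)] mult_right_mono mult_mono) auto
  qed
  have iter: "q (foldr partial_deriv ds P) \<le> (C * real (total_deg P) powr r) ^ length ds * q P"
    for ds P
  proof (induction ds)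
    case (Cons i ds)
    have "q (foldr partial_deriv (i # ds) P)
        \<le> C * real (total_deg P) powr r * q (foldr partial_deriv ds P)"
      using step[OF total_deg_foldr_partial_deriv] by simp
    also have "\<dots> \<le> C * real (total_deg P) powr r *
        ((C * real (total_deg P) powr r) ^ length ds * q P)"
      using Cons \<open>C > 0\<close> by (intro mult_left_mono) auto
    finally show ?case
      by (simp add: mult_ac)
  qed simp
  have "markov_mi \<alpha> q \<le> ereal (real k * r)" if \<alpha>: "mi_size \<alpha> = k" for \<alpha> :: "'n multi_index"
  proof -
    obtain ds where ds: "length ds = k" "\<And>P. mi_deriv \<alpha> P = foldr partial_deriv ds P"
      using mi_deriv_as_foldr[of \<alpha>] \<alpha> by metis
    \<comment> \<open>For \<open>n = 0\<close> this relies on \<open>k > 0\<close>: both sides are then \<open>0\<close>.\<close>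
    have "(real n powr r) ^ k = real n powr (real k * r)" for n
      using k by (cases "n = 0") (auto simp: powr_power mult.commute)
    then have "q (mi_deriv \<alpha> P) \<le> C ^ k * real (total_deg P) powr (real k * r) * q P" for P
      using iter[of ds P] ds by (simp add: power_mult_distrib)
    then have "markov_bound \<alpha> q (real k * r)"
      unfolding markov_bound_def using \<open>C > 0\<close> \<open>r > 0\<close> k by (auto intro!: exI[of _ "C ^ k"])
    then show ?thesis
      by (rule markov_mi_le)
  qed
  then show "markov_ord k q / ereal (real k) \<le> ereal r"
    using k by (simp add: ereal_divide_of_nat markov_ord_le)
qed

text \<open>
  The assumed inequality is applied to \<open>Q = (P - P(x))\<^sup>k\<close>, whose degree is at most \<open>k deg P\<close> and
  whose norm is at most \<open>(2 \<parallel>P\<parallel>)\<^sup>k\<close>, because the supremum norm is submultiplicative. At \<open>x\<close> the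
  derivative \<open>\<partial>\<^sub>i\<^sup>k Q\<close> is \<open>k! (\<partial>\<^sub>i P(x))\<^sup>k\<close>. The constant obtained does not depend on \<open>x\<close>, so that
  a supremum over \<open>x \<in> E\<close> can be taken afterwards.
\<close>

lemma norm_partial_deriv_power_le:
  assumes E: "compact E" "x \<in> E" and k: "k > 0" and r: "r > 0"
    and M: "M > 0" "\<And>P. sup_norm E ((partial_deriv i ^^ k) P)
      \<le> M * real (total_deg P) powr (real k * r) * sup_norm E P"
  shows "norm (eval_poly (partial_deriv i P) x)
    \<le> 2 * real k powr r * max 1 M * real (total_deg P) powr r * sup_norm E P"
proof -
  define c where "c = eval_poly P x"
  define G where "G = P + const_poly (- c)"
  have evalG: "eval_poly G y = eval_poly P y - c" for y
    by (simp add: G_def eval_poly_add eval_poly_const)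
  have derivG: "eval_poly (partial_deriv i G) x = eval_poly (partial_deriv i P) x"
  proof (rule DERIV_unique)
    show "((\<lambda>t. eval_poly G (x + axis i t)) has_field_derivative
        eval_poly (partial_deriv i G) x) (at 0)"
      by (rule eval_partial_deriv)
    show "((\<lambda>t. eval_poly G (x + axis i t)) has_field_derivative
        eval_poly (partial_deriv i P) x) (at 0)"
      unfolding evalG using DERIV_diff[OF eval_partial_deriv DERIV_const] by simp
  qed
  have nonneg: "sup_norm E P \<ge> 0" for P
    using norm_eval_le_sup_norm[OF E] norm_ge_zero order_trans by blast
  have "total_deg G \<le> total_deg P"
    using total_deg_add[of P "const_poly (- c)"] by (simp add: G_def total_deg_const_poly)
  then have "total_deg (G ^ k) \<le> k * total_deg P"
    using total_deg_power[of G k] mult_le_mono2 order_trans by blast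
  then have deg: "real (total_deg (G ^ k)) \<le> real k * real (total_deg P)"
    by (metis of_nat_le_iff of_nat_mult)
  have supG: "sup_norm E (G ^ k) \<le> (2 * sup_norm E P) ^ k"
  proof (rule sup_norm_le)
    fix y assume "y \<in> E"
    then have "norm (eval_poly G y) \<le> 2 * sup_norm E P"
      using norm_triangle_ineq4[of "eval_poly P y" c]
        norm_eval_le_sup_norm[OF E(1), of y P] norm_eval_le_sup_norm[OF E, of P]
      unfolding evalG c_def by linarith
    then show "norm (eval_poly (G ^ k) y) \<le> (2 * sup_norm E P) ^ k"
      unfolding eval_poly_power norm_power by (intro power_mono) auto
  qed (use E in auto)
  let ?d = "norm (eval_poly (partial_deriv i P) x)"
  have "eval_poly ((partial_deriv i ^^ k) (G ^ k)) x = fact k * eval_poly (partial_deriv i P) x ^ k"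
    using eval_iterated_partial_deriv_mult_power[of G x "G ^ k" "const_poly 1" k i]
    by (simp add: evalG c_def[symmetric] derivG eval_poly_const eval_poly_power)
  then have "fact k * ?d ^ k \<le> sup_norm E ((partial_deriv i ^^ k) (G ^ k))"
    using norm_eval_le_sup_norm[OF E, of "(partial_deriv i ^^ k) (G ^ k)"]
    by (simp add: norm_mult norm_power norm_fact)
  moreover have "?d ^ k \<le> fact k * ?d ^ k"
    by (simp add: mult_le_cancel_right1 fact_ge_1)
  ultimately have "?d ^ k \<le> M * real (total_deg (G ^ k)) powr (real k * r) * sup_norm E (G ^ k)"
    using M(2)[of "G ^ k"] by linarith
  \<comment> \<open>Every factor is made a \<open>k\<close>-th power, so that the root can be taken.\<close>
  also have "\<dots> \<le> max 1 M ^ k * (real k * real (total_deg P)) powr (real k * r) * (2 * sup_norm E P) ^ k"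
  proof (intro mult_mono powr_mono2 deg supG)
    have "max 1 M \<le> max 1 M ^ k"
      using k by (intro self_le_power) auto
    then show "M \<le> max 1 M ^ k"
      by linarith
  qed (use nonneg M(1) r in auto)
  also have "(real k * real (total_deg P)) powr (real k * r)
      = (real k powr r * real (total_deg P) powr r) ^ k"
    using k by (cases "total_deg P = 0") (auto simp: powr_mult powr_power power_mult_distrib mult.commute)
  finally have "?d ^ k \<le> (2 * real k powr r * max 1 M * real (total_deg P) powr r * sup_norm E P) ^ k"
    by (simp add: power_mult_distrib mult_ac)
  then show ?thesis
    using k nonneg by (subst (asm) power_mono_iff) auto
qed

lemma markov_exponent_le_markov_ord_sup_norm:
  assumes E: "compact E" and norm: "poly_norm (sup_norm E)" and "E \<noteq> {}" and k: "k > 0"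
  shows "markov_exponent (sup_norm E) \<le> markov_ord k (sup_norm E) / ereal (real k)"
proof (rule ereal_le_if_real_above)
  fix r assume "markov_ord k (sup_norm E) / ereal (real k) < ereal r"
  then have r: "markov_ord k (sup_norm E) < ereal (real k * r)"
    using k by (simp add: ereal_divide_of_nat)
  show "markov_exponent (sup_norm E) \<le> ereal r"
    unfolding markov_exponent_def
  proof (rule markov_ord_le)
    fix \<alpha> :: "'a multi_index" assume "mi_size \<alpha> = 1"
    then obtain i where i: "\<And>P. mi_deriv \<alpha> P = partial_deriv i P"
      using mi_deriv_size_1 by blast
    have "markov_bound (Poly_Mapping.single i k) (sup_norm E) (real k * r)"
      using norm markov_mi_le_markov_ord[OF mi_size_single, of i k "sup_norm E"] r
      by (intro markov_bound_if_gt) auto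
    then obtain M where M: "M > 0" "\<And>P. sup_norm E ((partial_deriv i ^^ k) P)
        \<le> M * real (total_deg P) powr (real k * r) * sup_norm E P" and "r > 0"
      using k by (auto simp: markov_bound_def mi_deriv_single zero_less_mult_iff)
    define C where "C = 2 * real k powr r * max 1 M"
    have "C > 0"
      using k by (auto simp: C_def)
    have "sup_norm E (mi_deriv \<alpha> P) \<le> C * real (total_deg P) powr r * sup_norm E P" for P
      unfolding i C_def using \<open>E \<noteq> {}\<close>
      by (rule sup_norm_le) (rule norm_partial_deriv_power_le[OF E _ k \<open>r > 0\<close> M])
    with \<open>C > 0\<close> \<open>r > 0\<close> have "markov_bound \<alpha> (sup_norm E) r"
      unfolding markov_bound_def by blast
    then show "markov_mi \<alpha> (sup_norm E) \<le> ereal r"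
      by (rule markov_mi_le)
  qed
qed

text \<open>
  A comparison of two norms on nonconstant polynomials carries over to constants, where all norms
  are proportional. Stating it for any degree bound \<open>n \<ge> 1\<close> makes it applicable to derivatives,
  which may be constant.
\<close>

lemma comparison_with_degree_bound:
  fixes p q :: "'n::finite cpoly \<Rightarrow> real"
  assumes p: "poly_norm p" and q: "poly_norm q" and "B > 0" and b: "b \<ge> 0"
    and B: "\<And>P. total_deg P \<ge> 1 \<Longrightarrow> q P \<le> B * real (total_deg P) powr b * p P"
  obtains C where "C > 0"
    "\<And>P n. total_deg P \<le> n \<Longrightarrow> n \<ge> 1 \<Longrightarrow> q P \<le> C * real n powr b * p P"
proof
  define C where "C = max B (q 1 / p 1)"
  show "C > 0"
    using \<open>B > 0\<close> by (simp add: C_def)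
  fix P :: "'n cpoly" and n assume n: "total_deg P \<le> n" "n \<ge> (1::nat)"
  have pP: "p P \<ge> 0"
    using p by (rule poly_norm_const)
  show "q P \<le> C * real n powr b * p P"
  proof (cases "total_deg P = 0")
    case True
    then obtain c where P: "P = const_poly c"
      using total_deg_0_imp_const by blast
    have "q P = q 1 / p 1 * 1 * p P"
      using poly_norm_const(2)[OF p]
      by (simp add: P poly_norm_const(1)[OF p] poly_norm_const(1)[OF q])
    also have "\<dots> \<le> C * real n powr b * p P"
      using n b pP \<open>C > 0\<close> by (intro mult_right_mono mult_mono) (auto simp: C_def ge_one_powr_ge_zero)
    finally show ?thesis .
  next
    case False
    then have "q P \<le> B * real (total_deg P) powr b * p P"
      by (intro B) simp
    also have "\<dots> \<le> C * real n powr b * p P"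
      using n b pP \<open>C > 0\<close> by (intro mult_right_mono mult_mono powr_mono2) (auto simp: C_def)
    finally show ?thesis .
  qed
qed

lemma markov_ord_le_comparison:
  fixes p q :: "'n::finite cpoly \<Rightarrow> real"
  assumes p: "poly_norm p" and q: "poly_norm q" and k: "k > 0"
    and A: "A > 0" "a \<ge> 0" "\<And>P. total_deg P \<ge> 1 \<Longrightarrow> p P \<le> A * real (total_deg P) powr a * q P"
    and B: "B > 0" "b \<ge> 0" "\<And>P. total_deg P \<ge> 1 \<Longrightarrow> q P \<le> B * real (total_deg P) powr b * p P"
  shows "markov_ord k q \<le> markov_ord k p + ereal (a + b)"
proof (rule ereal_le_if_real_above)
  fix r assume "markov_ord k p + ereal (a + b) < ereal r"
  then have r: "markov_ord k p < ereal (r - (a + b))"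
    by (cases "markov_ord k p") auto
  obtain C where C: "C > 0" "\<And>P n. total_deg P \<le> n \<Longrightarrow> n \<ge> 1 \<Longrightarrow> q P \<le> C * real n powr b * p P"
    using comparison_with_degree_bound[OF p q B] by blast
  show "markov_ord k q \<le> ereal r"
  proof (rule markov_ord_le)
    fix \<alpha> :: "'n multi_index" assume \<alpha>: "mi_size \<alpha> = k"
    have "markov_bound \<alpha> p (r - (a + b))"
      using p markov_mi_le_markov_ord[OF \<alpha>, of p] r by (intro markov_bound_if_gt) auto
    then obtain M where M: "M > 0"
      "\<And>P. p (mi_deriv \<alpha> P) \<le> M * real (total_deg P) powr (r - (a + b)) * p P"
      and "r > 0"
      using A(2) B(2) unfolding markov_bound_def by auto
    have "q (mi_deriv \<alpha> P) \<le> C * M * A * real (total_deg P) powr r * q P" for P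
    proof (cases "total_deg P = 0")
      case True
      then show ?thesis
        using mi_deriv_eq_0[of P \<alpha>] \<alpha> k poly_norm_const(3)[OF q] by simp
    next
      case False
      let ?n = "real (total_deg P)"
      have n: "?n > 0"
        using False by simp
      have "q (mi_deriv \<alpha> P) \<le> C * ?n powr b * p (mi_deriv \<alpha> P)"
        using False by (intro C(2) total_deg_mi_deriv) simp
      also have "\<dots> \<le> C * ?n powr b * (M * ?n powr (r - (a + b)) * p P)"
        using C(1) by (intro mult_left_mono M(2)) auto
      also have "\<dots> \<le> C * ?n powr b * (M * ?n powr (r - (a + b)) * (A * ?n powr a * q P))"
        using C(1) M(1) False by (intro mult_left_mono A(3)) auto
      also have "\<dots> = C * M * A * (?n powr b * ?n powr (r - (a + b)) * ?n powr a) * q P"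
        by (simp add: mult_ac)
      also have "?n powr b * ?n powr (r - (a + b)) * ?n powr a = ?n powr r"
        by (simp flip: powr_add)
      finally show ?thesis .
    qed
    then have "markov_bound \<alpha> q r"
      unfolding markov_bound_def using A(1) C(1) M(1) \<open>r > 0\<close> by (intro conjI exI[of _ "C * M * A"]) auto
    then show "markov_mi \<alpha> q \<le> ereal r"
      by (rule markov_mi_le)
  qed
qed

section \<open>The asymptotic exponent\<close>

lemma tendsto_divide_of_nat_if_close:
  fixes f g :: "nat \<Rightarrow> ereal"
  assumes "m \<ge> 0" and f: "\<And>k. k > 0 \<Longrightarrow> f k / ereal (real k) = m"
    and fg: "\<And>k. k > 0 \<Longrightarrow> f k \<le> g k + ereal c" and gf: "\<And>k. k > 0 \<Longrightarrow> g k \<le> f k + ereal c"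
  shows "(\<lambda>k. g k / ereal (real k)) \<longlonglongrightarrow> m"
proof (cases m)
  case (real r)
  have fk: "f k = ereal (real k * r)" if "k > 0" for k
    using f[OF that] that real by (cases "f k") (auto simp: field_simps)
  have lower: "ereal (r - c / real k) \<le> g k / ereal (real k)" if "k > 0" for k
    using fk[OF that] fg[OF that] that
    by (cases "g k") (auto simp: diff_le_eq pos_le_divide_eq mult.commute simp flip: add_divide_distrib)
  have upper: "g k / ereal (real k) \<le> ereal (r + c / real k)" if "k > 0" for k
    using fk[OF that] gf[OF that] that by (cases "g k") (auto simp: field_simps)
  have "(\<lambda>k. r - c / real k) \<longlonglongrightarrow> r - 0" "(\<lambda>k. r + c / real k) \<longlonglongrightarrow> r + 0"
    by (intro tendsto_intros lim_const_over_n)+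
  then have lim: "(\<lambda>k. ereal (r - c / real k)) \<longlonglongrightarrow> m" "(\<lambda>k. ereal (r + c / real k)) \<longlonglongrightarrow> m"
    by (simp_all add: real)
  show ?thesis
    by (rule tendsto_sandwich[OF _ _ lim]; use eventually_gt_at_top[of "0::nat"] in eventually_elim)
      (rule lower upper; assumption)+
next
  case PInf
  have "g k / ereal (real k) = m" if "k > 0" for k
    using f[OF that] fg[OF that] that PInf by (cases "f k"; cases "g k") auto
  then have "\<forall>\<^sub>F k in sequentially. g k / ereal (real k) = m"
    by (rule eventually_mono[OF eventually_gt_at_top[of 0]])
  then show ?thesis
    by (rule tendsto_eventually)
qed (use \<open>m \<ge> 0\<close> in auto)

theorem corollary25:
  fixes E :: "(complex ^ 'n::finite) set" and q :: "'n cpoly \<Rightarrow> real"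
  assumes "compact E"
    and "admissible_norm E q"
  shows "asymptotic_exponent q = markov_exponent_set E \<and>
    (\<lambda>k. markov_ord k q / ereal (real k)) \<longlonglongrightarrow> markov_exponent_set E \<and>
    markov_exponent_set E \<le> markov_exponent q"
proof -
  let ?e = "sup_norm E"
  have ne: "E \<noteq> {}"
    using assms(2) by (rule admissible_norm_imp_nonempty)
  have e: "poly_norm ?e"
    using assms by (rule poly_norm_sup_norm)
  from assms(2) obtain A B a b where q: "poly_norm q"
    and A: "A > 0" "a \<ge> 0" "\<And>P. total_deg P \<ge> 1 \<Longrightarrow> ?e P \<le> A * real (total_deg P) powr a * q P"
    and B: "B > 0" "b \<ge> 0" "\<And>P. total_deg P \<ge> 1 \<Longrightarrow> q P \<le> B * real (total_deg P) powr b * ?e P"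
    unfolding admissible_norm_def by blast
  have lim: "(\<lambda>k. markov_ord k q / ereal (real k)) \<longlonglongrightarrow> markov_exponent_set E"
  proof (rule tendsto_divide_of_nat_if_close)
    show "markov_exponent_set E \<ge> 0"
      by (simp add: markov_exponent_set_def markov_exponent_def markov_ord_nonneg)
    fix k :: nat assume k: "k > 0"
    show "markov_ord k ?e / ereal (real k) = markov_exponent_set E"
      unfolding markov_exponent_set_def
      using markov_ord_le_iterate[OF e k]
        markov_exponent_le_markov_ord_sup_norm[OF assms(1) e ne k] by (rule order_antisym)
    show "markov_ord k ?e \<le> markov_ord k q + ereal (a + b)"
      using markov_ord_le_comparison[OF q e k B A] by (simp add: add.commute)
    show "markov_ord k q \<le> markov_ord k ?e + ereal (a + b)"
      using markov_ord_le_comparison[OF e q k A B] .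
  qed
  moreover have "markov_exponent_set E \<le> markov_exponent q"
    using lim
  proof (rule tendsto_upperbound)
    show "\<forall>\<^sub>F k in sequentially. markov_ord k q / ereal (real k) \<le> markov_exponent q"
      using eventually_gt_at_top[of "0::nat"]
      by eventually_elim (rule markov_ord_le_iterate[OF q])
  qed simp
  ultimately show ?thesis
    unfolding asymptotic_exponent_def using lim_imp_Limsup[OF _ lim] by simp
qed

end
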